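(* Let $E(t)$ be a real function of $t\ge 0$ such that the following conditions are satisfied: (i) $\lim_{t\to 0+}E(t)=1$; (ii) $\lim_{t\to\infty}E(t)=0$; (iii) $E(t)$ is at least once differentiable on $(0,\infty)$; (iv) $E'(t)\le 0$ for all $t\ge 0$ (at $t=0$, $E'$ is the right-hand derivative). Then $E$ is the expected value function of a switch process with a $GD(2)$ switching time distribution.
   Context: Switch process: let $(T_k)_{k\ge 1}$ be i.i.d. non-negative random variables with distribution function $F$ (the switching time distribution), where $F$ is absolutely continuous with respect to Lebesgue measure with a density that is bounded on any closed interval of the positive half-line, and $F(0)=0$. Define $N(t)=\sup\{n\in\mathbb{N}:\sum_{k=1}^n T_k\le t\}$ for $t\ge T_1$ and $N(t)=0$ for $0\le t<T_1$. The switch process is $X(t)=(-1)^{N(t)}$, $t\ge 0$; its expected value function is $t\mapsto\mathbb{E}[X(t)]$. Geometric divisibility: for $r>1$, a distribution $F$ of a non-negative random variable $W$ belongs to $GD(r)$ if $W$ has the same distribution as $\sum_{k=1}^{\nu_p}\tilde W_k$, where $\nu_p$ is geometric with $P(\nu_p=k)=(1-p)^{k-1}p$, $k=1,2,\dots$, $r=\mathbb{E}\nu_p=1/p$, and $(\tilde W_k)_{k\ge1}$ are i.i.d. non-negative random variables independent of $\nu_p$.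
   Formalization: The requirement that the switching time distribution have a density bounded on closed intervals is proved only when E' is bounded on each [0,b], since it can fail otherwise; GD(2), absolute continuity, F(0)=0 and E(t)=E[X(t)] are proved in general. *)

theory Defs
  imports "HOL-Probability.Probability"
begin

text \<open>
  Distributions on the line are represented by Borel probability measures, and sequences
  \<open>T\<close> of random variables are indexed by \<open>k \<ge> 1\<close>; the value \<open>T 0\<close> plays no role.
\<close>

definition iid_nonneg :: "'a measure \<Rightarrow> (nat \<Rightarrow> 'a \<Rightarrow> real) \<Rightarrow> real measure \<Rightarrow> bool" where
  "iid_nonneg M T F \<longleftrightarrow>
     prob_space M \<and>
     prob_space.indep_vars M (\<lambda>_. borel) T {1..} \<and>
     (\<forall>k\<ge>1. distr M borel (T k) = F \<and> (\<forall>\<omega>\<in>space M. 0 \<le> T k \<omega>))"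

text \<open>
  If the partial sums of the switching times stay bounded, the supremum below is taken over an
  infinite set of naturals and is unspecified. This is a null event as soon as
  \<open>F(0) = 0\<close>.
\<close>

definition num_switches :: "(nat \<Rightarrow> 'a \<Rightarrow> real) \<Rightarrow> real \<Rightarrow> 'a \<Rightarrow> nat" where
  "num_switches T t \<omega> =
     (if T 1 \<omega> \<le> t then Sup {n. (\<Sum>k=1..n. T k \<omega>) \<le> t} else 0)"

definition switch_process :: "(nat \<Rightarrow> 'a \<Rightarrow> real) \<Rightarrow> real \<Rightarrow> 'a \<Rightarrow> real" where
  "switch_process T t \<omega> = (-1) ^ num_switches T t \<omega>"

definition lebesgue_density :: "real measure \<Rightarrow> (real \<Rightarrow> real) \<Rightarrow> bool" where
  "lebesgue_density F f \<longleftrightarrow>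
     f \<in> borel_measurable borel \<and> (\<forall>x. 0 \<le> f x) \<and> F = density lborel (\<lambda>x. ennreal (f x))"

text \<open>
  Two notions are kept apart because a differentiable survival function may have a locally
  unbounded derivative: absolute continuity alone, and with a locally bounded density. In the
  latter, the left end point \<open>0\<close> is allowed, so the density is also bounded near \<open>0\<close>.
\<close>

definition ac_switching_distribution :: "real measure \<Rightarrow> bool" where
  "ac_switching_distribution F \<longleftrightarrow>
     prob_space F \<and> cdf F 0 = 0 \<and> (\<exists>f. lebesgue_density F f)"

definition switching_distribution :: "real measure \<Rightarrow> bool" where
  "switching_distribution F \<longleftrightarrow>
     prob_space F \<and> cdf F 0 = 0 \<and>
     (\<exists>f. lebesgue_density F f \<and> (\<forall>a b. 0 \<le> a \<and> a \<le> b \<longrightarrow> bounded (f ` {a..b})))"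

definition expected_value_function :: "real measure \<Rightarrow> (real \<Rightarrow> real) \<Rightarrow> bool" where
  "expected_value_function F E \<longleftrightarrow>
     (\<exists>(M :: (nat \<Rightarrow> real) measure) T.
        iid_nonneg M T F \<and>
        (\<forall>t\<ge>0. E t = prob_space.expectation M (switch_process T t)))"

text \<open>
  The sample space carries the pair of the geometric variable and the sequence of summands;
  fixing its type loses no generality, since only their joint law matters.
\<close>

definition GD :: "real \<Rightarrow> real measure set" where
  "GD r = {F. r > 1 \<and>
     (\<exists>(M :: (nat \<times> (nat \<Rightarrow> real)) measure) \<nu> W G.
        iid_nonneg M W G \<and>
        \<nu> \<in> measurable M (count_space UNIV) \<and>
        (\<forall>k\<ge>1. measure M {\<omega>\<in>space M. \<nu> \<omega> = k} = (1 - 1 / r) ^ (k - 1) * (1 / r)) \<and>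
        prob_space.indep_set M
          (sets (vimage_algebra (space M) \<nu> (count_space UNIV)))
          (sets (vimage_algebra (space M) (\<lambda>\<omega>. \<lambda>k\<in>{1..}. W k \<omega>) (PiM {1..} (\<lambda>_. borel)))) \<and>
        F = distr M borel (\<lambda>\<omega>. \<Sum>k=1..\<nu> \<omega>. W k \<omega>))}"

end

theory Submission imports Defs begin

text \<open>
  Let \<open>G\<close> be the distribution with survival function \<open>E\<close> (its density is \<open>-E'\<close>), and let
  \<open>F\<close> be the law of a sum of a geometric number, of mean 2, of independent copies of \<open>G\<close>.
  Splitting off the first summand gives \<open>2 F = G + F * G\<close>, hence
  \<open>2 a (n + 1) = b n + b (n + 1)\<close> where \<open>a n\<close> and \<open>b n\<close> are the values at \<open>t\<close> of the
  distribution functions of \<open>F\<^sup>n\<close> and \<open>F\<^sup>n * G\<close> (convolution powers). As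
  \<open>E[X(t)]\<close> is the alternating sum of the \<open>a n - a (n + 1)\<close>, the relation makes it
  telescope to \<open>1 - b 0 = 1 - G(t) = E(t)\<close>. The identity \<open>2 F = G + F * G\<close> also shows that
  \<open>F\<close> has a density, bounded on every interval \<open>[0, b]\<close> on which \<open>-E'\<close> is.
\<close>

section \<open>Sums of i.i.d. variables\<close>

primrec conv_power :: "real measure \<Rightarrow> nat \<Rightarrow> real measure" where
  "conv_power F 0 = return borel 0"
| "conv_power F (Suc n) = (F \<star> conv_power F n)"

lemma sets_conv_power [simp, measurable_cong]: "sets (conv_power F n) = sets borel"
  by (cases n) auto

lemma space_conv_power [simp]: "space (conv_power F n) = UNIV"
  using sets_eq_imp_space_eq[OF sets_conv_power] by simp

lemma prob_space_convolution:
  fixes M N :: "real measure"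
  assumes "prob_space M" "prob_space N"
    and [measurable_cong]: "sets M = sets borel" "sets N = sets borel"
  shows "prob_space (M \<star> N)"
proof -
  interpret M: prob_space M by fact
  interpret N: prob_space N by fact
  interpret pair_prob_space M N ..
  show ?thesis
    unfolding convolution_def by (rule prob_space_distr) measurable
qed

lemma prob_space_conv_power:
  assumes "prob_space F" "sets F = sets borel"
  shows "prob_space (conv_power F n)"
  by (induction n) (auto intro!: prob_space_convolution prob_space_return assms)

lemma convolution_return_0:
  fixes F :: "real measure"
  assumes "finite_measure F" and [measurable_cong]: "sets F = sets borel"
  shows "(F \<star> return borel 0) = F"
proof (rule measure_eqI)
  fix A assume "A \<in> sets (F \<star> return borel 0)"
  then have [measurable]: "A \<in> sets borel" by simp
  have "emeasure (F \<star> return borel 0) A = (\<integral>\<^sup>+x. indicator A x \<partial>F)"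
    using assms by (simp add: convolution_emeasure' prob_space.finite_measure[OF prob_space_return]
       nn_integral_return)
  then show "emeasure (F \<star> return borel 0) A = emeasure F A"
    using assms by (simp )
qed (use assms in simp)

lemma iid_nonneg_distr_sum:
  assumes "iid_nonneg M T F"
  shows "distr M borel (\<lambda>\<omega>. \<Sum>k=1..n. T k \<omega>) = conv_power F n"
proof -
  from assms interpret prob_space M by (simp add: iid_nonneg_def)
  have ind: "indep_vars (\<lambda>_. borel) T {1..}" and F: "\<And>k. k \<ge> 1 \<Longrightarrow> distr M borel (T k) = F"
    using assms by (auto simp: iid_nonneg_def)
  have [measurable]: "T k \<in> borel_measurable M" if "k \<ge> 1" for k
    using ind that by (auto simp: indep_vars_def)
  show ?thesis
  proof (induction n)
    case 0
    show ?case
      by (rule measure_eqI) (auto simp: emeasure_distr emeasure_space_1 indicator_def)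
  next
    case (Suc n)
    have sum[measurable]: "(\<lambda>\<omega>. \<Sum>k=1..n. T k \<omega>) \<in> borel_measurable M"
      by (intro borel_measurable_sum) auto
    have T[measurable]: "T (Suc n) \<in> borel_measurable M" by simp
    have "indep_var borel (T (Suc n)) borel (\<lambda>\<omega>. \<Sum>k=1..n. T k \<omega>)"
      by (intro indep_vars_sum indep_vars_subset[OF ind]) auto
    then have "distr M borel (\<lambda>\<omega>. T (Suc n) \<omega> + (\<Sum>k=1..n. T k \<omega>)) =
        (distr M borel (T (Suc n)) \<star> distr M borel (\<lambda>\<omega>. \<Sum>k=1..n. T k \<omega>))"
      by (rule sum_indep_random_variable[OF _ T sum])
    then show ?case
      using Suc.IH F by (simp add: add.commute)
  qed
qed

text \<open>Being i.i.d. depends only on the joint law, which a map \<open>f\<close> pushing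
  \<open>N\<close> to \<open>M\<close> preserves. This carries the coordinate sequence of a product
  over to a larger space on which a geometric variable lives as well.\<close>

lemma iid_nonneg_transfer:
  assumes iid: "iid_nonneg M T F" and N: "prob_space N"
    and f: "f \<in> measurable N M" and d: "distr N M f = M"
  shows "iid_nonneg N (\<lambda>k \<omega>. T k (f \<omega>)) F"
proof -
  interpret M: prob_space M using iid by (simp add: iid_nonneg_def)
  interpret N: prob_space N by fact
  note f[measurable]
  have ind: "M.indep_vars (\<lambda>_. borel) T {1..}"
    using iid by (auto simp: iid_nonneg_def)
  have [measurable]: "T k \<in> borel_measurable M" if "k \<in> {1..}" for k
    using ind that by (auto simp: M.indep_vars_def)
  have *: "distr N borel (\<lambda>\<omega>. T k (f \<omega>)) = distr M borel (T k)" if "k \<in> {1..}" for k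
    using that d distr_distr[of "T k" M borel f N] by (simp add: comp_def)
  have r: "(\<lambda>\<omega>. \<lambda>k\<in>{1..}. T k \<omega>) \<in> measurable M (PiM {1..} (\<lambda>_. borel))"
    by (intro measurable_restrict) auto
  have "N.indep_vars (\<lambda>_. borel) (\<lambda>k \<omega>. T k (f \<omega>)) {1..}"
  proof (subst N.indep_vars_iff_distr_eq_PiM')
    have "distr N (PiM {1..} (\<lambda>_. borel)) (\<lambda>x. \<lambda>i\<in>{1..}. T i (f x)) =
        distr M (PiM {1..} (\<lambda>_. borel)) (\<lambda>x. \<lambda>i\<in>{1..}. T i x)"
      using distr_distr[OF r f] by (simp add: d comp_def)
    also have "\<dots> = PiM {1..} (\<lambda>i. distr M borel (T i))"
      using ind by (subst (asm) M.indep_vars_iff_distr_eq_PiM') auto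
    also have "\<dots> = PiM {1..} (\<lambda>i. distr N borel (\<lambda>\<omega>. T i (f \<omega>)))"
      by (intro PiM_cong) (auto simp: *)
    finally show "distr N (PiM {1..} (\<lambda>_. borel)) (\<lambda>x. \<lambda>i\<in>{1..}. T i (f x)) =
        PiM {1..} (\<lambda>i. distr N borel (\<lambda>\<omega>. T i (f \<omega>)))" .
  qed auto
  then show ?thesis
    using iid measurable_space[OF f] * N by (auto simp: iid_nonneg_def)
qed

text \<open>Existence of i.i.d. sequences with a prescribed law, realized by product coordinates.
  Clipping at 0 gives nonnegativity at every sample point; by \<open>pos\<close> it alters each
  coordinate only on a null set, so the law stays \<open>F\<close>.\<close>

lemma iid_nonneg_PiM:
  assumes F: "prob_space F" and S: "sets F = sets borel" and pos: "AE x in F. 0 \<le> x"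
  shows "iid_nonneg (PiM (UNIV :: nat set) (\<lambda>_. F)) (\<lambda>k w. max 0 (w k)) F"
proof -
  interpret F: prob_space F by fact
  interpret P: product_prob_space "\<lambda>_. F" "UNIV :: nat set" ..
  note S[measurable_cong]
  let ?M = "PiM (UNIV :: nat set) (\<lambda>_. F)"
  have c: "distr ?M borel (\<lambda>w. w i) = F" for i
  proof -
    have "distr ?M borel (\<lambda>w. w i) = distr ?M F (\<lambda>w. w i)"
      by (rule distr_cong) (auto simp: S)
    also have "\<dots> = F" by (rule P.PiM_component) simp
    finally show ?thesis .
  qed
  have "P.indep_vars (\<lambda>_. borel) (\<lambda>i w. w i) UNIV"
  proof (subst P.indep_vars_iff_distr_eq_PiM')
    have "distr ?M (PiM UNIV (\<lambda>_. borel)) (\<lambda>x. \<lambda>i\<in>UNIV. x i) = distr ?M ?M (\<lambda>x. x)"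
      by (intro distr_cong sets_PiM_cong) (auto simp: S)
    then show "distr ?M (PiM UNIV (\<lambda>_. borel)) (\<lambda>x. \<lambda>i\<in>UNIV. x i) =
        PiM UNIV (\<lambda>i. distr ?M borel (\<lambda>w. w i))"
      by (simp add: c)
  qed auto
  then have "P.indep_vars (\<lambda>_. borel) (\<lambda>i w. max 0 (w i)) UNIV"
    by (rule P.indep_vars_compose2) auto
  then have "P.indep_vars (\<lambda>_. borel) (\<lambda>i w. max 0 (w i)) {1..}"
    by (rule P.indep_vars_subset) auto
  moreover have "distr ?M borel (\<lambda>w. max 0 (w i)) = F" for i
  proof -
    have "distr ?M borel (\<lambda>w. max 0 (w i)) = distr (distr ?M borel (\<lambda>w. w i)) borel (max 0)"
      by (subst distr_distr) (auto simp: comp_def)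
    also have "\<dots> = distr F F (\<lambda>x. x)"
      unfolding c by (rule distr_cong_AE) (use pos in \<open>auto simp: S\<close>)
    finally show ?thesis by simp
  qed
  ultimately show ?thesis
    by (auto simp: iid_nonneg_def P.prob_space_axioms)
qed

section \<open>Geometric sums\<close>

lemma distr_pair_snd:
  assumes "prob_space N" "prob_space M"
  shows "distr (N \<Otimes>\<^sub>M M) M snd = M"
proof -
  interpret N: prob_space N by fact
  interpret M: prob_space M by fact
  show ?thesis
  proof (rule measure_eqI)
    fix A assume A: "A \<in> sets (distr (N \<Otimes>\<^sub>M M) M snd)"
    then have "snd -` A \<inter> space (N \<Otimes>\<^sub>M M) = space N \<times> A"
      using sets.sets_into_space by (fastforce simp: space_pair_measure)
    with A show "emeasure (distr (N \<Otimes>\<^sub>M M) M snd) A = emeasure M A"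
      by (simp add: emeasure_distr M.emeasure_pair_measure_Times N.emeasure_space_1)
  qed simp
qed

text \<open>The coordinates are clipped at 0, since nonnegativity is demanded at every sample point.\<close>

definition geometric_sum :: "real measure \<Rightarrow> real measure" where
  "geometric_sum G =
     distr (measure_pmf (map_pmf Suc (geometric_pmf (1/2))) \<Otimes>\<^sub>M PiM UNIV (\<lambda>_::nat. G)) borel
       (\<lambda>\<omega>. \<Sum>k=1..fst \<omega>. max 0 (snd \<omega> k))"

lemma sets_geometric_sum [simp, measurable_cong]: "sets (geometric_sum G) = sets borel"
  by (simp add: geometric_sum_def)

lemma measurable_random_sum:
  fixes G :: "real measure"
  assumes S: "sets G = sets borel"
  shows "(\<lambda>\<omega>. \<Sum>k=1..fst \<omega>. max 0 (snd \<omega> k))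
    \<in> borel_measurable (measure_pmf (\<nu> :: nat pmf) \<Otimes>\<^sub>M PiM UNIV (\<lambda>_::nat. G))"
proof -
  have "(\<lambda>\<omega>. snd \<omega> k) \<in> measurable (measure_pmf \<nu> \<Otimes>\<^sub>M PiM UNIV (\<lambda>_::nat. G)) G" for k
    by (rule measurable_compose[OF measurable_snd measurable_component_singleton]) simp
  then have "(\<lambda>\<omega>. \<Sum>k=1..n. max 0 (snd \<omega> k)) \<in> borel_measurable (measure_pmf \<nu> \<Otimes>\<^sub>M PiM UNIV (\<lambda>_::nat. G))" for n
    unfolding measurable_cong_sets[OF refl S]
    by (intro borel_measurable_sum borel_measurable_max borel_measurable_const) auto
  then show ?thesis
    \<comment> \<open>The number of summands takes countably many values, so each fixed
      \<open>n\<close> can be treated separately.\<close>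
    by (intro measurable_compose_countable[where f="\<lambda>n \<omega>. \<Sum>k=1..n. max 0 (snd \<omega> k)" and g=fst]) auto
qed

text \<open>Memorylessness: with probability 1/2 the first trial succeeds, and otherwise the count
  restarts, increased by one.\<close>

lemma nn_integral_geometric_pmf_half:
  "(\<integral>\<^sup>+n. f n \<partial>measure_pmf (geometric_pmf (1/2))) =
     1/2 * f 0 + 1/2 * (\<integral>\<^sup>+n. f (Suc n) \<partial>measure_pmf (geometric_pmf (1/2)))"
  by (subst geometric_bind_pmf_unfold) (auto simp: divide_ennreal_def mult.commute)

context
  fixes G :: "real measure"
  assumes G: "prob_space G" and S [measurable_cong]: "sets G = sets borel"
    and pos: "AE x in G. 0 \<le> x"
begin

interpretation G: prob_space G by (rule G)

interpretation P: product_prob_space "\<lambda>_. G" "UNIV :: nat set" ..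

interpretation Q: pair_prob_space "measure_pmf (map_pmf Suc (geometric_pmf (1/2)))"
  "PiM UNIV (\<lambda>_::nat. G)" ..

lemma prob_space_geometric_sum: "prob_space (geometric_sum G)"
  unfolding geometric_sum_def by (rule Q.prob_space_distr) (use S in measurable)

lemma AE_geometric_sum_nonneg: "AE x in geometric_sum G. 0 \<le> x"
  unfolding geometric_sum_def
  by (subst AE_distr_iff) (use S in \<open>auto intro!: sum_nonneg\<close>)

text \<open>Fubini amounts to conditioning on the number of summands. Since
  \<open>geometric_pmf\<close> starts at 0, the shifted count appears as the exponent
  \<open>Suc n\<close>.\<close>

lemma nn_integral_geometric_sum:
  assumes [measurable]: "h \<in> borel_measurable borel"
  shows "(\<integral>\<^sup>+x. h x \<partial>geometric_sum G) =
    (\<integral>\<^sup>+n. \<integral>\<^sup>+x. h x \<partial>conv_power G (Suc n) \<partial>measure_pmf (geometric_pmf (1/2)))"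
proof -
  note measurable_random_sum[OF S, measurable]
  have *: "(\<integral>\<^sup>+w. h (\<Sum>k=1..n. max 0 (w k)) \<partial>PiM UNIV (\<lambda>_. G)) = (\<integral>\<^sup>+x. h x \<partial>conv_power G n)" for n
    by (subst iid_nonneg_distr_sum[OF iid_nonneg_PiM[OF G S pos], symmetric]) (simp add: nn_integral_distr)
  have "(\<integral>\<^sup>+x. h x \<partial>geometric_sum G) =
      (\<integral>\<^sup>+\<omega>. h (\<Sum>k=1..fst \<omega>. max 0 (snd \<omega> k))
         \<partial>(measure_pmf (map_pmf Suc (geometric_pmf (1/2))) \<Otimes>\<^sub>M PiM UNIV (\<lambda>_. G)))"
    by (simp add: geometric_sum_def nn_integral_distr)
  also have "\<dots> = (\<integral>\<^sup>+n. \<integral>\<^sup>+w. h (\<Sum>k=1..n. max 0 (w k)) \<partial>PiM UNIV (\<lambda>_. G)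
         \<partial>measure_pmf (map_pmf Suc (geometric_pmf (1/2))))"
    by (subst P.nn_integral_fst[symmetric]) simp_all
  finally show ?thesis
    unfolding * by simp
qed

text \<open>The sum is a single copy of \<open>G\<close> or, with equal probability, a fresh copy
  added to another geometric sum. Testing against arbitrary nonnegative \<open>h\<close> avoids
  adding measures and lets \<open>h\<close> later be an indicator or an inner integral of a
  convolution.\<close>

lemma geometric_sum_renewal:
  assumes [measurable]: "h \<in> borel_measurable borel"
  shows "2 * (\<integral>\<^sup>+x. h x \<partial>geometric_sum G) =
    (\<integral>\<^sup>+x. h x \<partial>G) + (\<integral>\<^sup>+x. h x \<partial>(geometric_sum G \<star> G))"
proof -
  interpret F: prob_space "geometric_sum G" by (rule prob_space_geometric_sum)
  interpret C: prob_space "conv_power G n" for n by (rule prob_space_conv_power[OF G S])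
  \<comment> \<open>Commutativity makes the extra copy of \<open>G\<close> the inner integral. What
    remains is one function of \<open>x\<close>, the same for all \<open>n\<close>, to which
    \<open>nn_integral_geometric_sum\<close> applies in place of \<open>h\<close>.\<close>
  have "(\<integral>\<^sup>+x. h x \<partial>conv_power G (Suc (Suc n))) =
      (\<integral>\<^sup>+x. \<integral>\<^sup>+y. h (x + y) \<partial>G \<partial>conv_power G (Suc n))" for n
    unfolding conv_power.simps(2)[of G "Suc n"]
    by (subst convolution_commutative)
      (auto simp: S nn_integral_convolution G.finite_measure_axioms C.finite_measure_axioms simp del: conv_power.simps)
  moreover have "(\<integral>\<^sup>+x. h x \<partial>(geometric_sum G \<star> G)) = (\<integral>\<^sup>+x. \<integral>\<^sup>+y. h (x + y) \<partial>G \<partial>geometric_sum G)"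
    by (auto simp: S nn_integral_convolution G.finite_measure_axioms F.finite_measure_axioms)
  moreover have "\<dots> = (\<integral>\<^sup>+n. \<integral>\<^sup>+x. \<integral>\<^sup>+y. h (x + y) \<partial>G \<partial>conv_power G (Suc n) \<partial>measure_pmf (geometric_pmf (1/2)))"
    by (rule nn_integral_geometric_sum) measurable
  moreover have "conv_power G (Suc 0) = G"
    by (simp add: convolution_return_0 S G.finite_measure_axioms)
  ultimately have *: "(\<integral>\<^sup>+x. h x \<partial>geometric_sum G) =
      1/2 * (\<integral>\<^sup>+x. h x \<partial>G) + 1/2 * (\<integral>\<^sup>+x. h x \<partial>(geometric_sum G \<star> G))"
    unfolding nn_integral_geometric_sum[OF assms]
    by (subst nn_integral_geometric_pmf_half) (simp del: conv_power.simps)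
  have "2 * (1 / 2 * x) = (x :: ennreal)" for x
    by (simp add: mult.assoc[symmetric] ennreal_times_divide)
  then show ?thesis
    unfolding * by (simp add: distrib_left)
qed

lemma geometric_sum_GD: "geometric_sum G \<in> GD 2"
proof -
  note measurable_random_sum[OF S, measurable]
  let ?N = "measure_pmf (map_pmf Suc (geometric_pmf (1/2)))"
  let ?P = "PiM UNIV (\<lambda>_::nat. G)"
  let ?M = "?N \<Otimes>\<^sub>M ?P"
  let ?W = "\<lambda>k \<omega>. max 0 (snd \<omega> k) :: real"
  have iid: "iid_nonneg ?M ?W G"
    by (rule iid_nonneg_transfer[OF iid_nonneg_PiM[OF G S pos] Q.prob_space_axioms measurable_snd])
       (rule distr_pair_snd[OF measure_pmf.prob_space_axioms P.prob_space_axioms])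
  \<comment> \<open>The shift by \<open>Suc\<close> moves the mass that \<open>geometric_pmf\<close>
    puts on \<open>k - 1\<close> to \<open>k\<close>.\<close>
  have geo: "measure ?M {\<omega>\<in>space ?M. fst \<omega> = k} = (1 - 1 / 2) ^ (k - 1) * (1 / 2)" if "k \<ge> 1" for k
  proof -
    have "measure ?M {\<omega>\<in>space ?M. fst \<omega> = k} = measure (distr ?M ?N fst) {k}"
      by (subst measure_distr) (auto intro!: arg_cong[where f="measure ?M"])
    also have "distr ?M ?N fst = ?N" by (rule P.distr_pair_fst)
    also have "measure ?N {k} = pmf (geometric_pmf (1/2)) (k - 1)"
      using that by (cases k) (auto simp: measure_pmf_single[symmetric] vimage_def)
    finally show ?thesis using that by simp
  qed
  have r: "(\<lambda>w. \<lambda>k\<in>{1..}. max 0 (w k)) \<in> measurable ?P (PiM {1..} (\<lambda>_. borel :: real measure))"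
    by (intro measurable_restrict) measurable
  have r': "(\<lambda>\<omega>. \<lambda>k\<in>{1..}. ?W k \<omega>) \<in> measurable ?M (PiM {1..} (\<lambda>_. borel))"
    using measurable_compose[OF measurable_snd r] .
  have "Q.indep_set (sets (vimage_algebra (space ?M) fst (count_space UNIV)))
       (sets (vimage_algebra (space ?M) (\<lambda>\<omega>. \<lambda>k\<in>{1..}. ?W k \<omega>) (PiM {1..} (\<lambda>_. borel))))"
    unfolding Q.indep_sets2_eq
  proof (intro conjI ballI)
    show "sets (vimage_algebra (space ?M) fst (count_space UNIV)) \<subseteq> Q.events"
      using measurable_sets[of fst ?M "count_space UNIV"] by (subst sets_vimage_algebra2) auto
    show "sets (vimage_algebra (space ?M) (\<lambda>\<omega>. \<lambda>k\<in>{1..}. ?W k \<omega>) (PiM {1..} (\<lambda>_. borel))) \<subseteq> Q.events"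
      using measurable_sets[OF r'] measurable_space[OF r'] by (subst sets_vimage_algebra2) auto
    fix a b
    assume "a \<in> sets (vimage_algebra (space ?M) fst (count_space UNIV))"
      and "b \<in> sets (vimage_algebra (space ?M) (\<lambda>\<omega>. \<lambda>k\<in>{1..}. ?W k \<omega>) (PiM {1..} (\<lambda>_. borel)))"
    then obtain A B where B: "B \<in> sets (PiM {1..} (\<lambda>_. borel))" and ab: "a = fst -` A \<inter> space ?M"
        "b = (\<lambda>\<omega>. \<lambda>k\<in>{1..}. ?W k \<omega>) -` B \<inter> space ?M"
      using measurable_space[OF r'] by (subst (asm) (1 2) sets_vimage_algebra2) auto
    define C where "C = (\<lambda>w. \<lambda>k\<in>{1..}. max 0 (w k)) -` B \<inter> space ?P"
    have C: "C \<in> sets ?P" unfolding C_def by (rule measurable_sets[OF r B])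
    \<comment> \<open>Each event constrains one factor only, so both are rectangles and the product
      measure multiplies.\<close>
    have "a = A \<times> space ?P" "b = space ?N \<times> C" "a \<inter> b = A \<times> C"
      using sets.sets_into_space[OF C] by (auto simp: ab C_def space_pair_measure)
    then show "Q.prob (a \<inter> b) = Q.prob a * Q.prob b"
      using C P.emeasure_space_1
      by (simp add: measure_def P.emeasure_pair_measure_Times enn2real_mult)
  qed
  then show ?thesis
    unfolding GD_def mem_Collect_eq using iid geo
    by (intro conjI exI[of _ ?M] exI[of _ fst] exI[of _ ?W] exI[of _ G])
       (auto simp: geometric_sum_def)
qed

end

section \<open>The renewal equation and the switch process\<close>

text \<open>The Laplace transform at 1 turns convolution into multiplication, because exp(-(x + y))
  factors.\<close>

lemma conv_power_laplace:
  assumes F: "prob_space F" and S [measurable_cong]: "sets F = sets borel"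
  shows "(\<integral>\<^sup>+x. ennreal (exp (- x)) \<partial>conv_power F n) = (\<integral>\<^sup>+x. ennreal (exp (- x)) \<partial>F) ^ n"
proof (induction n)
  case 0
  show ?case by (simp add: nn_integral_return)
next
  case (Suc n)
  interpret F: prob_space F by fact
  interpret C: prob_space "conv_power F n" by (rule prob_space_conv_power[OF F S])
  have "(\<integral>\<^sup>+x. ennreal (exp (- x)) \<partial>conv_power F (Suc n)) =
      (\<integral>\<^sup>+x. \<integral>\<^sup>+y. ennreal (exp (- x)) * ennreal (exp (- y)) \<partial>conv_power F n \<partial>F)"
    by (simp add: nn_integral_convolution F.finite_measure_axioms C.finite_measure_axioms S
        ennreal_mult[symmetric] exp_add[symmetric] add.commute)
  also have "\<dots> = (\<integral>\<^sup>+x. ennreal (exp (- x)) \<partial>F) ^ Suc n"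
    by (simp add: nn_integral_cmult nn_integral_multc Suc.IH)
  finally show ?case .
qed

text \<open>Chernoff bound: the indicator of x \<le> t is at most exp(t - x), so the measure is at
  most exp(t) \<open>L ^ n\<close>, where \<open>L\<close> is the Laplace transform of
  \<open>F\<close> at 1. Strict positivity of the switching times gives
  \<open>L < 1\<close>.\<close>

lemma conv_power_tendsto_0:
  assumes F: "prob_space F" and S [measurable_cong]: "sets F = sets borel" and pos: "AE x in F. 0 < x"
  shows "(\<lambda>n. measure (conv_power F n) {..t}) \<longlonglongrightarrow> 0"
proof -
  interpret F: prob_space F by fact
  interpret C: prob_space "conv_power F n" for n by (rule prob_space_conv_power[OF F S])
  define L where "L = F.expectation (\<lambda>x. exp (- x))"
  have int: "integrable F (\<lambda>x. exp (- x))"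
  proof (rule F.integrable_const_bound[where B=1])
    show "AE x in F. norm (exp (- x)) \<le> 1"
      using pos by eventually_elim simp
  qed measurable
  have L0: "0 \<le> L"
    unfolding L_def by simp
  have L1: "L < 1"
    unfolding L_def using pos by (intro F.expectation_less int) (auto elim: eventually_mono)
  have nn: "(\<integral>\<^sup>+x. ennreal (exp (- x)) \<partial>conv_power F n) = ennreal (L ^ n)" for n
    unfolding conv_power_laplace[OF F S] L_def
    using L0 by (simp add: nn_integral_eq_integral[OF int] ennreal_power L_def)
  have le: "measure (conv_power F n) {..t} \<le> exp t * L ^ n" for n
  proof -
    have *: "1 \<le> ennreal (exp t) * ennreal (exp (- x))" if "x \<le> t" for x
    proof -
      have "1 \<le> exp (t - x)" using that by simp
      also have "exp (t - x) = exp t * exp (- x)" by (simp add: mult_exp_exp)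
      finally show ?thesis by (simp add: ennreal_mult'[symmetric] ennreal_ge_1)
    qed
    have "emeasure (conv_power F n) {..t} = (\<integral>\<^sup>+x. indicator {..t} x \<partial>conv_power F n)"
      by simp
    also have "\<dots> \<le> (\<integral>\<^sup>+x. ennreal (exp t) * ennreal (exp (- x)) \<partial>conv_power F n)"
      by (intro nn_integral_mono) (auto simp: indicator_def intro: *)
    also have "\<dots> = ennreal (exp t * L ^ n)"
      using L0 by (simp add: nn_integral_cmult nn ennreal_mult)
    finally show ?thesis
      using L0 by (simp add: C.emeasure_eq_measure)
  qed
  have "(\<lambda>n. exp t * L ^ n) \<longlonglongrightarrow> exp t * 0"
    using L0 L1 by (intro tendsto_mult LIMSEQ_realpow_zero tendsto_const) auto
  then have "(\<lambda>n. exp t * L ^ n) \<longlonglongrightarrow> 0" by simp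
  then show ?thesis
    by (rule tendsto_sandwich[OF _ _ tendsto_const, rotated 2]) (simp_all add: le)
qed

section \<open>Telescoping of the alternating sum through the renewal equation\<close>

context
  fixes F G :: "real measure"
  assumes F: "prob_space F" and SF [measurable_cong]: "sets F = sets borel" and posF: "AE x in F. 0 < x"
    and G: "prob_space G" and SG [measurable_cong]: "sets G = sets borel"
    and renewal: "\<And>h. h \<in> borel_measurable borel \<Longrightarrow>
      2 * (\<integral>\<^sup>+x. h x \<partial>F) = (\<integral>\<^sup>+x. h x \<partial>G) + (\<integral>\<^sup>+x. h x \<partial>(F \<star> G))"
begin

interpretation F: prob_space F by (rule F)
interpretation G: prob_space G by (rule G)
interpretation C: prob_space "conv_power F n" for n by (rule prob_space_conv_power[OF F SF])
interpretation D: prob_space "conv_power F n \<star> G" for n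
  by (rule prob_space_convolution) (auto simp: SG C.prob_space_axioms G)

text \<open>This is the renewal equation convolved with the n-th convolution power of
  \<open>F\<close>.\<close>

lemma conv_power_renewal:
  assumes [measurable]: "A \<in> sets borel"
  shows "2 * measure (conv_power F (Suc n)) A =
    measure (conv_power F n \<star> G) A + measure (conv_power F (Suc n) \<star> G) A"
proof -
  note fin = F.finite_measure_axioms G.finite_measure_axioms C.finite_measure_axioms
  have FG: "finite_measure (F \<star> G)"
    by (intro convolution_finite fin SF SG)
  \<comment> \<open>Integrating \<open>?h\<close> against a measure evaluates the convolution of
    that measure with \<open>conv_power F n\<close> at \<open>A\<close>, so \<open>?h\<close> is the
    test function that performs the convolution.\<close>
  let ?h = "\<lambda>x. \<integral>\<^sup>+y. indicator A (x + y) \<partial>conv_power F n"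
  have "2 * emeasure (conv_power F (Suc n)) A = 2 * (\<integral>\<^sup>+x. ?h x \<partial>F)"
    by (simp add: convolution_emeasure' fin SF)
  also have "\<dots> = (\<integral>\<^sup>+x. ?h x \<partial>G) + (\<integral>\<^sup>+x. ?h x \<partial>(F \<star> G))"
    by (rule renewal) measurable
  also have "(\<integral>\<^sup>+x. ?h x \<partial>G) = emeasure (G \<star> conv_power F n) A"
    by (simp add: convolution_emeasure' fin SG)
  also have "(G \<star> conv_power F n) = (conv_power F n \<star> G)"
    by (rule convolution_commutative) (auto simp: fin SG)
  also have "(\<integral>\<^sup>+x. ?h x \<partial>(F \<star> G)) = emeasure ((F \<star> G) \<star> conv_power F n) A"
    by (subst convolution_emeasure') (simp_all add: fin FG)
  also have "((F \<star> G) \<star> conv_power F n) = (F \<star> (G \<star> conv_power F n))"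
    by (rule convolution_associative[symmetric]) (auto simp: fin SG SF)
  also have "(G \<star> conv_power F n) = (conv_power F n \<star> G)"
    by (rule convolution_commutative) (auto simp: fin SG)
  also have "(F \<star> (conv_power F n \<star> G)) = (conv_power F (Suc n) \<star> G)"
    unfolding conv_power.simps by (rule convolution_associative) (auto simp: fin SG SF)
  finally have "ennreal (2 * measure (conv_power F (Suc n)) A) =
      ennreal (measure (conv_power F n \<star> G) A + measure (conv_power F (Suc n) \<star> G) A)"
    by (simp add: C.emeasure_eq_measure D.emeasure_eq_measure ennreal_mult
       del: conv_power.simps)
  then show ?thesis
    by (subst (asm) ennreal_inj) auto
qed

lemma alternating_conv_power_tendsto:
  assumes "0 \<le> t"
  shows "(\<lambda>n. \<Sum>k<n. (-1) ^ k * (measure (conv_power F k) {..t} - measure (conv_power F (Suc k)) {..t}))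
    \<longlonglongrightarrow> 1 - measure G {..t}"
proof -
  define a where "a n = measure (conv_power F n) {..t}" for n
  define b where "b n = measure (conv_power F n \<star> G) {..t}" for n
  have ab: "2 * a (Suc n) = b n + b (Suc n)" for n
    unfolding a_def b_def by (rule conv_power_renewal) auto
  \<comment> \<open>The zeroth power is the point mass at 0, which lies in \<open>{..t}\<close>
    because t \<ge> 0.\<close>
  have a0: "a 0 = 1"
    using assms by (simp add: a_def measure_return)
  have b0: "b 0 = measure G {..t}"
    unfolding b_def
    by (simp add: convolution_commutative[of "return borel 0" G] convolution_return_0
      G.finite_measure_axioms prob_space.finite_measure[OF prob_space_return] SG)
  have a: "a \<longlonglongrightarrow> 0"
    unfolding a_def by (rule conv_power_tendsto_0[OF F SF posF])
  have b: "b \<longlonglongrightarrow> 0"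
  proof (rule tendsto_sandwich[OF _ _ tendsto_const])
    show "\<forall>\<^sub>F n in sequentially. 0 \<le> b n" by (simp add: b_def)
    have "b n \<le> 2 * a (Suc n)" for n
      using ab[of n] measure_nonneg[of "conv_power F (Suc n) \<star> G" "{..t}"] by (simp add: b_def)
    then show "\<forall>\<^sub>F n in sequentially. b n \<le> 2 * a (Suc n)" by simp
    show "(\<lambda>n. 2 * a (Suc n)) \<longlonglongrightarrow> 0"
      using tendsto_mult[OF tendsto_const LIMSEQ_Suc[OF a], of 2] by simp
  qed
  \<comment> \<open>With d n = b n - a n, relation \<open>ab\<close> reads a n - a (n + 1) = -(d n +
    d (n + 1)). The alternating sum therefore collapses to -d 0 plus a boundary term, and -d 0 = 1 -
    b 0.\<close>
  have "(\<Sum>k<n. (-1) ^ k * (a k - a (Suc k))) = 1 - b 0 + (-1) ^ n * (b n - a n)" for n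
  proof (induction n)
    case (Suc n)
    have *: "a n - a (Suc n) = - (b (Suc n) - a (Suc n)) - (b n - a n)"
      using ab[of n] by simp
    then show ?case
      by (simp only: sum.lessThan_Suc Suc.IH *) (simp add: algebra_simps)
  qed (simp add: a0)
  moreover have "(\<lambda>n. (-1) ^ n * (b n - a n)) \<longlonglongrightarrow> 0"
  proof (rule tendsto_norm_zero_cancel)
    show "(\<lambda>n. norm ((-1) ^ n * (b n - a n))) \<longlonglongrightarrow> 0"
      using tendsto_norm_zero[OF tendsto_diff[OF b a, simplified]] by (simp add: abs_mult power_abs)
  qed
  ultimately show ?thesis
    using tendsto_add[OF tendsto_const, of _ 0 sequentially "1 - b 0"]
    by (simp add: a_def[symmetric] b0 del: conv_power.simps)
qed

end

section \<open>From sample paths to the expectation\<close>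

lemma count_upto_cases:
  fixes s :: "nat \<Rightarrow> 'a :: linorder"
  assumes "incseq s" "s 0 \<le> t"
  obtains "\<And>n. s n \<le> t" | N where "\<And>n. s n \<le> t \<longleftrightarrow> n \<le> N"
proof (cases "\<forall>n. s n \<le> t")
  case False
  define m where "m = (LEAST n. \<not> s n \<le> t)"
  have m: "\<not> s m \<le> t" unfolding m_def using False by (metis LeastI_ex)
  have "s n \<le> t" if "n < m" for n using that not_less_Least unfolding m_def by blast
  moreover have "\<not> s n \<le> t" if "n \<ge> m" for n
    using m incseqD[OF assms(1) that] by auto
  \<comment> \<open>The last index below the first failure \<open>m\<close> is \<open>m - 1\<close>,
    a genuine predecessor because s 0 \<le> t.\<close>
  moreover have "m \<noteq> 0" using m assms(2) by metis
  ultimately have "s n \<le> t \<longleftrightarrow> n \<le> m - 1" for n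
    by (metis One_nat_def Suc_pred less_Suc_eq_le not_le neq0_conv)
  then show ?thesis using that(2) by blast
qed (use that in blast)

text \<open>The difference of consecutive indicators is 1 exactly at \<open>k = N\<close>, that is,
  when precisely k switches have occurred. The sum thus picks out the sign \<open>(-1) ^ N\<close>
  as soon as its range contains \<open>N\<close>.\<close>

lemma alternating_indicator_sum:
  assumes "\<And>n. s n \<le> t \<longleftrightarrow> n \<le> N"
  shows "(\<Sum>k<n. (-1) ^ k * (of_bool (s k \<le> t) - of_bool (s (Suc k) \<le> t))) =
    (if N < n then (-1) ^ N else 0 :: real)"
proof -
  have "(\<Sum>k<n. (-1) ^ k * (of_bool (s k \<le> t) - of_bool (s (Suc k) \<le> t))) =
      (\<Sum>k<n. if k = N then (-1) ^ k else 0 :: real)"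
    by (intro sum.cong) (auto simp: assms)
  then show ?thesis by simp
qed

lemma num_switches_eq:
  assumes "\<And>n. (\<Sum>k=1..n. T k \<omega>) \<le> t \<longleftrightarrow> n \<le> N"
  shows "num_switches T t \<omega> = N"
proof -
  have "{n. (\<Sum>k=1..n. T k \<omega>) \<le> t} = {..N}" using assms by auto
  moreover have "Sup {..N} = N" by (intro cSup_eq_maximum) auto
  moreover have "T 1 \<omega> \<le> t \<longleftrightarrow> 1 \<le> N" using assms[of 1] by simp
  ultimately show ?thesis by (auto simp: num_switches_def)
qed

text \<open>The process is almost surely the limit of alternating sums of indicators of the events
  that the k-th partial sum is at most t. Dominated convergence passes this limit to the
  expectations.\<close>

lemma expectation_switch_process:
  assumes iid: "iid_nonneg M T F"
    and F: "prob_space F" "sets F = sets borel" "AE x in F. 0 < x" and t: "0 \<le> t"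
    and lim: "(\<lambda>n. \<Sum>k<n. (-1) ^ k * (measure (conv_power F k) {..t} - measure (conv_power F (Suc k)) {..t}))
    \<longlonglongrightarrow> l"
  shows "prob_space.expectation M (switch_process T t) = l"
proof -
  interpret prob_space M using iid by (simp add: iid_nonneg_def)
  have T[measurable]: "T k \<in> borel_measurable M" if "k \<in> {1..}" for k
    using iid that by (auto simp: iid_nonneg_def indep_vars_def)
  define s where "s n \<omega> = (\<Sum>k=1..n. T k \<omega>)" for n \<omega>
  have s[measurable]: "s n \<in> borel_measurable M" for n
    unfolding s_def by (intro borel_measurable_sum T) auto
  have distr: "distr M borel (s n) = conv_power F n" for n
    unfolding s_def by (rule iid_nonneg_distr_sum[OF iid])
  have prob_s: "prob {\<omega>\<in>space M. s n \<omega> \<le> t} = measure (conv_power F n) {..t}" for n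
    unfolding distr[symmetric] by (subst measure_distr) (auto intro!: arg_cong[where f=prob])
  have inc: "incseq (\<lambda>n. s n \<omega>)" if "\<omega> \<in> space M" for \<omega>
    using iid that by (intro incseq_SucI) (auto simp: s_def iid_nonneg_def)
  define P where "P n \<omega> = (\<Sum>k<n. (-1) ^ k * (of_bool (s k \<omega> \<le> t) - of_bool (s (Suc k) \<omega> \<le> t)) :: real)"
    for n \<omega>
  have P[measurable]: "P n \<in> borel_measurable M" for n
    unfolding P_def by measurable
  \<comment> \<open>On the null event \<open>B\<close> the process has the unspecified but constant value \<open>c\<close>.\<close>
  define B where "B = {\<omega>\<in>space M. \<forall>n. s n \<omega> \<le> t}"
  have B[measurable]: "B \<in> events" unfolding B_def by measurable
  define c :: real where "c = (-1) ^ Sup (UNIV :: nat set)"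
  have cases: "(\<omega> \<in> B \<and> switch_process T t \<omega> = c \<and> (\<forall>n. P n \<omega> = 0)) \<or>
      (\<omega> \<notin> B \<and> (\<exists>N. switch_process T t \<omega> = (-1) ^ N \<and> (\<forall>n. P n \<omega> = (if N < n then (-1) ^ N else 0))))"
    if \<omega>: "\<omega> \<in> space M" for \<omega>
  proof (rule count_upto_cases[OF inc[OF \<omega>], of t])
    show "s 0 \<omega> \<le> t" using t by (simp add: s_def)
  next
    assume *: "\<And>n. s n \<omega> \<le> t"
    have "{n. (\<Sum>k=1..n. T k \<omega>) \<le> t} = UNIV" "T 1 \<omega> \<le> t"
      using * *[of 1] by (auto simp: s_def)
    then have "switch_process T t \<omega> = c"
      by (simp add: switch_process_def num_switches_def c_def)
    then show ?thesis using * \<omega> by (simp add: B_def P_def)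
  next
    fix N assume *: "\<And>n. s n \<omega> \<le> t \<longleftrightarrow> n \<le> N"
    have "num_switches T t \<omega> = N"
      using * by (intro num_switches_eq) (simp add: s_def)
    moreover have "\<omega> \<notin> B" using *[of "Suc N"] by (auto simp: B_def)
    moreover have "P n \<omega> = (if N < n then (-1) ^ N else 0)" for n
      unfolding P_def by (rule alternating_indicator_sum) (rule *)
    ultimately show ?thesis by (auto simp: switch_process_def)
  qed
  \<comment> \<open>The correction on \<open>B\<close> makes the convergence hold at every sample
    point, not merely almost surely; measurability of the process follows from this.\<close>
  have conv: "(\<lambda>n. P n \<omega> + c * indicator B \<omega>) \<longlonglongrightarrow> switch_process T t \<omega>" if "\<omega> \<in> space M" for \<omega>
    using cases[OF that]
  proof (elim disjE conjE exE)
    fix N assume *: "switch_process T t \<omega> = (-1) ^ N" "\<forall>n. P n \<omega> = (if N < n then (-1) ^ N else 0)" "\<omega> \<notin> B"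
    show ?thesis
      by (rule tendsto_eventually, rule eventually_mono[OF eventually_gt_at_top[of N]]) (simp add: *)
  qed simp
  have [measurable]: "switch_process T t \<in> borel_measurable M"
    by (rule borel_measurable_LIMSEQ_real[OF conv]) auto
  \<comment> \<open>\<open>B\<close> is contained in the event that the n-th partial sum is at most
    t, for every n, and these probabilities tend to 0.\<close>
  have "prob B \<le> measure (conv_power F n) {..t}" for n
    unfolding prob_s[symmetric] by (intro finite_measure_mono) (auto simp: B_def)
  then have "prob B \<le> 0"
    by (intro tendsto_lowerbound[OF conv_power_tendsto_0[OF F, of t]]) auto
  then have "prob B = 0" using measure_nonneg[of M B] by linarith
  then have AE_B: "AE \<omega> in M. \<omega> \<notin> B"
    using prob_eq_0[OF B] by simp
  have "(\<lambda>n. expectation (P n)) \<longlonglongrightarrow> expectation (switch_process T t)"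
  proof (rule integral_dominated_convergence[where w="\<lambda>_. 1"])
    show "AE \<omega> in M. (\<lambda>n. P n \<omega>) \<longlonglongrightarrow> switch_process T t \<omega>"
      using AE_B AE_space by eventually_elim (use conv in \<open>force simp: indicator_def\<close>)
    \<comment> \<open>By \<open>cases\<close>, each \<open>P n\<close> only takes the values 0, 1
      and -1.\<close>
    show "AE \<omega> in M. norm (P n \<omega>) \<le> 1" for n
      using cases by (intro AE_I2) (fastforce simp: power_abs)
  qed auto
  moreover have "expectation (P n) =
      (\<Sum>k<n. (-1) ^ k * (measure (conv_power F k) {..t} - measure (conv_power F (Suc k)) {..t}))" for n
  proof -
    have 1: "expectation (\<lambda>\<omega>. of_bool (s k \<omega> \<le> t)) = measure (conv_power F k) {..t}"
      and 2: "integrable M (\<lambda>\<omega>. of_bool (s k \<omega> \<le> t) :: real)" for k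
    proof -
      have "expectation (\<lambda>\<omega>. of_bool (s k \<omega> \<le> t) :: real) =
          expectation (indicator {\<omega>\<in>space M. s k \<omega> \<le> t})"
        by (intro Bochner_Integration.integral_cong) (auto simp: indicator_def)
      then show "expectation (\<lambda>\<omega>. of_bool (s k \<omega> \<le> t)) = measure (conv_power F k) {..t}"
        by (simp add: prob_s)
      show "integrable M (\<lambda>\<omega>. of_bool (s k \<omega> \<le> t) :: real)"
        by (rule integrable_const_bound[where B=1]) auto
    qed
    show ?thesis
      unfolding P_def by (simp add: 1 2 del: conv_power.simps)
  qed
  ultimately show ?thesis
    using lim by (simp add: LIMSEQ_unique del: conv_power.simps)
qed


section \<open>Densities\<close>

text \<open>A density of one factor suffices: translating and applying Tonelli shows that the
  convolution has the \<open>F\<close>-average of the translates of \<open>g\<close> as density. It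
  stays extended-valued, since this average may be infinite at some points.\<close>

lemma density_convolution:
  fixes F :: "real measure" and g :: "real \<Rightarrow> real"
  assumes F: "finite_measure F" and S [measurable_cong]: "sets F = sets borel"
    and g [measurable]: "g \<in> borel_measurable borel"
    and fin: "finite_measure (density lborel (\<lambda>x. ennreal (g x)))"
  shows "(F \<star> density lborel (\<lambda>x. ennreal (g x))) =
    density lborel (\<lambda>x. \<integral>\<^sup>+y. ennreal (g (x - y)) \<partial>F)"
proof (rule measure_eqI)
  interpret F: finite_measure F by fact
  interpret pair_sigma_finite F lborel ..
  fix A assume "A \<in> sets (F \<star> density lborel (\<lambda>x. ennreal (g x)))"
  then have A[measurable]: "A \<in> sets borel" by simp
  have "emeasure (F \<star> density lborel (\<lambda>x. ennreal (g x))) A =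
      (\<integral>\<^sup>+y. \<integral>\<^sup>+x. ennreal (g x) * indicator A (y + x) \<partial>lborel \<partial>F)"
    by (simp add: convolution_emeasure' F fin S nn_integral_density)
  also have "\<dots> = (\<integral>\<^sup>+y. \<integral>\<^sup>+x. ennreal (g (x - y)) * indicator A x \<partial>lborel \<partial>F)"
  proof (rule nn_integral_cong)
    fix y
    show "(\<integral>\<^sup>+x. ennreal (g x) * indicator A (y + x) \<partial>lborel) =
        (\<integral>\<^sup>+x. ennreal (g (x - y)) * indicator A x \<partial>lborel)"
      by (subst nn_integral_real_affine[where c=1 and t="-y"]) (auto simp: one_ennreal_def[symmetric])
  qed
  also have "\<dots> = (\<integral>\<^sup>+x. \<integral>\<^sup>+y. ennreal (g (x - y)) * indicator A x \<partial>F \<partial>lborel)"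
    by (rule Fubini'[symmetric]) measurable
  also have "\<dots> = (\<integral>\<^sup>+x. (\<integral>\<^sup>+y. ennreal (g (x - y)) \<partial>F) * indicator A x \<partial>lborel)"
    by (intro nn_integral_cong nn_integral_multc) measurable
  also have "\<dots> = emeasure (density lborel (\<lambda>x. \<integral>\<^sup>+y. ennreal (g (x - y)) \<partial>F)) A"
    by (rule emeasure_density[symmetric]) measurable
  finally show "emeasure (F \<star> density lborel (\<lambda>x. ennreal (g x))) A =
     emeasure (density lborel (\<lambda>x. \<integral>\<^sup>+y. ennreal (g (x - y)) \<partial>F)) A" .
qed simp

text \<open>The renewal equation exhibits \<open>F\<close> as the mean of \<open>G\<close> and F
  \<star> G, both absolutely continuous. As \<open>F\<close> lives on the nonnegative half-line, its
  convolution term at x \<le> b only sees \<open>g\<close> at points x - y \<le> b, so a bound for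
  \<open>g\<close> there is inherited without loss.\<close>

lemma renewal_lebesgue_density:
  fixes F :: "real measure" and g :: "real \<Rightarrow> real"
  assumes F: "prob_space F" and S [measurable_cong]: "sets F = sets borel" and pos: "AE x in F. 0 \<le> x"
    and g [measurable]: "g \<in> borel_measurable borel" and g0: "\<And>x. 0 \<le> g x" "\<And>x. x \<le> 0 \<Longrightarrow> g x = 0"
    and G: "prob_space (density lborel (\<lambda>x. ennreal (g x)))"
    and renewal: "\<And>h. h \<in> borel_measurable borel \<Longrightarrow>
      2 * (\<integral>\<^sup>+x. h x \<partial>F) = (\<integral>\<^sup>+x. h x \<partial>density lborel (\<lambda>x. ennreal (g x))) +
         (\<integral>\<^sup>+x. h x \<partial>(F \<star> density lborel (\<lambda>x. ennreal (g x))))"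
  obtains f where "lebesgue_density F f"
    "\<And>b K. (\<And>x. x \<le> b \<Longrightarrow> g x \<le> K) \<Longrightarrow> (\<And>x. x \<le> b \<Longrightarrow> f x \<le> K)"
proof -
  interpret F: prob_space F by fact
  let ?G = "density lborel (\<lambda>x. ennreal (g x))"
  interpret G: prob_space ?G by fact
  define k where "k x = (ennreal (g x) + (\<integral>\<^sup>+y. ennreal (g (x - y)) \<partial>F)) / 2" for x
  have k[measurable]: "k \<in> borel_measurable borel" unfolding k_def by measurable
  have two_k: "2 * k x = ennreal (g x) + (\<integral>\<^sup>+y. ennreal (g (x - y)) \<partial>F)" for x
    unfolding k_def ennreal_times_divide mult.commute[of 2] by (rule mult_divide_eq_ennreal) auto
  have Fk: "F = density lborel k"
  proof (rule measure_eqI)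
    fix A assume "A \<in> sets F"
    then have [measurable]: "A \<in> sets borel" by (simp add: S)
    have "2 * emeasure F A = emeasure ?G A + emeasure (F \<star> ?G) A"
      using renewal[of "indicator A"] by (simp add: S)
    also have "\<dots> = (\<integral>\<^sup>+x. ennreal (g x) * indicator A x \<partial>lborel) +
        (\<integral>\<^sup>+x. (\<integral>\<^sup>+y. ennreal (g (x - y)) \<partial>F) * indicator A x \<partial>lborel)"
      by (simp add: density_convolution F.finite_measure_axioms S G.finite_measure_axioms emeasure_density)
    also have "\<dots> = (\<integral>\<^sup>+x. 2 * (k x * indicator A x) \<partial>lborel)"
      by (subst nn_integral_add[symmetric])
        (auto intro!: nn_integral_cong simp: two_k indicator_def)
    also have "\<dots> = 2 * emeasure (density lborel k) A"
      by (simp add: nn_integral_cmult emeasure_density)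
    finally show "emeasure F A = emeasure (density lborel k) A"
      by (simp add: ennreal_mult_cancel_left)
  qed (simp add: S)
  \<comment> \<open>The total mass is 1, so \<open>k\<close> is finite almost everywhere and passing
    to \<open>enn2real\<close> leaves the measure unchanged.\<close>
  have "AE x in lborel. k x \<noteq> \<infinity>"
  proof (rule nn_integral_PInf_AE)
    have "(\<integral>\<^sup>+x. k x \<partial>lborel) = emeasure (density lborel k) (space lborel)"
      by (simp add: emeasure_density)
    also have "\<dots> = 1"
      using F.emeasure_space_1 by (subst Fk[symmetric]) (simp add: sets_eq_imp_space_eq[OF S])
    finally show "(\<integral>\<^sup>+x. k x \<partial>lborel) \<noteq> \<infinity>" by simp
  qed simp
  then have "density lborel k = density lborel (\<lambda>x. ennreal (enn2real (k x)))"
    by (intro density_cong) (auto simp: ennreal_enn2real_if)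
  with Fk have "lebesgue_density F (\<lambda>x. enn2real (k x))"
    by (simp add: lebesgue_density_def)
  moreover have "enn2real (k x) \<le> K" if b: "\<And>x. x \<le> b \<Longrightarrow> g x \<le> K" and x: "x \<le> b" for x b K
  proof -
    have K: "0 \<le> K" using b[OF x] g0(1)[of x] by linarith
    have "AE y in F. ennreal (g (x - y)) \<le> ennreal K"
      using pos by eventually_elim (use b x in \<open>auto intro!: ennreal_leI\<close>)
    then have "(\<integral>\<^sup>+y. ennreal (g (x - y)) \<partial>F) \<le> (\<integral>\<^sup>+y. ennreal K \<partial>F)"
      by (rule nn_integral_mono_AE)
    then have "k x \<le> (ennreal K + ennreal K) / 2"
      unfolding k_def using b[OF x]
      by (intro divide_right_mono_ennreal add_mono ennreal_leI) (auto simp: F.emeasure_space_1)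
    also have "\<dots> = ennreal K"
      using K by (simp add: ennreal_plus[symmetric] ennreal_divide_numeral del: ennreal_plus)
    finally show ?thesis
      using K by (intro enn2real_leI)
  qed
  ultimately show ?thesis using that by blast
qed

text \<open>\<open>E'\<close> need not be continuous, but the fundamental theorem of calculus for
  nonnegative Borel derivatives applies to \<open>- E'\<close>. The limits of \<open>E\<close> at 0
  and infinity make the total mass 1.\<close>

lemma survival_function_density:
  fixes E E' :: "real \<Rightarrow> real"
  assumes lim0: "(E \<longlongrightarrow> 1) (at_right 0)"
    and lim_infinity: "(E \<longlongrightarrow> 0) at_top"
    and deriv: "\<And>t. t > 0 \<Longrightarrow> (E has_real_derivative E' t) (at t)"
    and deriv0: "(E has_real_derivative E' 0) (at_right 0)"
    and deriv_nonpos: "\<And>t. t \<ge> 0 \<Longrightarrow> E' t \<le> 0"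
  defines "g \<equiv> \<lambda>x. if 0 < x then - E' x else 0"
  shows "g \<in> borel_measurable borel"
    and "prob_space (density lborel (\<lambda>x. ennreal (g x)))"
    and "\<And>t. 0 \<le> t \<Longrightarrow> measure (density lborel (\<lambda>x. ennreal (g x))) {..t} = 1 - E t"
proof -
  \<comment> \<open>Right differentiability at 0 includes right continuity there, which ties the
    value \<open>E 0\<close> to the limit 1.\<close>
  have "(E \<longlongrightarrow> E 0) (at_right 0)"
    using DERIV_continuous[OF deriv0] by (simp add: continuous_within)
  then have E0: "E 0 = 1"
    using tendsto_unique[OF _ _ lim0] by simp
  \<comment> \<open>\<open>- E\<close> is continued linearly to the left of 0, to be differentiable on the whole line.\<close>
  define H where "H x = (if x \<le> 0 then - 1 - E' 0 * x else - E x)" for x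
  define f where "f x = (if x \<le> 0 then - E' 0 else - E' x)" for x
  have Hd: "DERIV H x :> f x" for x
  proof (cases x "0 :: real" rule: linorder_cases)
    case less
    have "((\<lambda>x. - 1 - E' 0 * x) has_real_derivative f x) (at x)"
      using less by (auto intro!: derivative_eq_intros simp: f_def)
    then show ?thesis
      by (rule DERIV_cong_ev[THEN iffD1, rotated -1, OF _ refl _ refl])
        (use less in \<open>auto simp: H_def intro!: eventually_nhds_in_open[of "{..<0}", THEN eventually_mono]\<close>)
  next
    case greater
    have "((\<lambda>x. - E x) has_real_derivative f x) (at x)"
      using greater by (auto intro!: derivative_eq_intros deriv simp: f_def)
    then show ?thesis
      by (rule DERIV_cong_ev[THEN iffD1, rotated -1, OF _ refl _ refl])
        (use greater in \<open>auto simp: H_def intro!: eventually_nhds_in_open[of "{0<..}", THEN eventually_mono]\<close>)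
  next
    case equal
    have "((\<lambda>x. (H x - H 0) / (x - 0)) \<longlongrightarrow> - E' 0) (at 0)"
    proof (rule filterlim_split_at)
      have "eventually (\<lambda>x. (H x - H 0) / (x - 0) = - E' 0) (at_left 0)"
        by (auto simp: H_def eventually_at_filter)
      then show "((\<lambda>x. (H x - H 0) / (x - 0)) \<longlongrightarrow> - E' 0) (at_left 0)"
        by (rule tendsto_eventually)
      have "((\<lambda>x. - ((E x - E 0) / (x - 0))) \<longlongrightarrow> - E' 0) (at_right 0)"
        using deriv0 unfolding has_field_derivative_iff by (rule tendsto_minus)
      moreover have "eventually (\<lambda>x. - ((E x - E 0) / (x - 0)) = (H x - H 0) / (x - 0)) (at_right 0)"
        by (auto simp: H_def E0 eventually_at_filter field_simps)
      ultimately show "((\<lambda>x. (H x - H 0) / (x - 0)) \<longlongrightarrow> - E' 0) (at_right 0)"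
        by (rule Lim_transform_eventually)
    qed
    then show ?thesis
      using equal by (simp add: has_field_derivative_iff f_def)
  qed
  have [measurable]: "H \<in> borel_measurable borel"
    by (intro borel_measurable_continuous_onI continuous_at_imp_continuous_on ballI DERIV_isCont[OF Hd])
  \<comment> \<open>A derivative is a pointwise limit of difference quotients, here with step
    \<open>1 / real (Suc n)\<close>, and hence Borel.\<close>
  have f[measurable]: "f \<in> borel_measurable borel"
  proof (rule borel_measurable_LIMSEQ_real)
    fix x
    have "filterlim (\<lambda>n. 1 / real (Suc n)) (at 0) sequentially"
      using LIMSEQ_Suc[OF lim_1_over_n] by (auto simp: filterlim_at)
    with Hd[of x, unfolded DERIV_def]
    show "(\<lambda>n. (H (x + 1 / real (Suc n)) - H x) / (1 / real (Suc n))) \<longlonglongrightarrow> f x"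
      by (rule filterlim_compose)
  qed measurable
  have f0: "0 \<le> f x" for x
    using deriv_nonpos by (simp add: f_def)
  have Hlim: "(H \<longlongrightarrow> 0) at_top"
  proof (rule Lim_transform_eventually)
    show "((\<lambda>x. - E x) \<longlongrightarrow> 0) at_top" using tendsto_minus[OF lim_infinity] by simp
    show "eventually (\<lambda>x. - E x = H x) at_top"
      using eventually_gt_at_top[of 0] by eventually_elim (simp add: H_def)
  qed
  show g[measurable]: "g \<in> borel_measurable borel"
  proof -
    have "g = (\<lambda>x. if 0 < x then f x else 0)" by (auto simp: g_def f_def)
    then show ?thesis by simp
  qed
  \<comment> \<open>On the nonnegative half-line \<open>g\<close> and \<open>f\<close> can differ
    only at 0, where \<open>g\<close> is 0 and \<open>f\<close> is \<open>- E' 0\<close>.\<close>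
  have ae: "AE x in lborel. x \<noteq> (0::real)" by (rule AE_lborel_singleton)
  show P: "prob_space (density lborel (\<lambda>x. ennreal (g x)))"
  proof (rule prob_spaceI)
    have "emeasure (density lborel (\<lambda>x. ennreal (g x))) (space (density lborel (\<lambda>x. ennreal (g x)))) =
        (\<integral>\<^sup>+x. ennreal (g x) \<partial>lborel)"
      by (simp add: emeasure_density)
    also have "\<dots> = (\<integral>\<^sup>+x. ennreal (f x) * indicator {0..} x \<partial>lborel)"
      by (rule nn_integral_cong_AE, rule eventually_mono[OF ae]) (auto simp: g_def f_def indicator_def)
    also have "\<dots> = ennreal (0 - H 0)"
      by (rule nn_integral_FTC_atLeast) (auto simp: Hd f0 Hlim)
    finally show "emeasure (density lborel (\<lambda>x. ennreal (g x))) (space (density lborel (\<lambda>x. ennreal (g x)))) = 1"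
      by (simp add: H_def)
  qed
  interpret P: prob_space "density lborel (\<lambda>x. ennreal (g x))" by (rule P)
  show "measure (density lborel (\<lambda>x. ennreal (g x))) {..t} = 1 - E t" if t: "0 \<le> t" for t
  proof -
    have "emeasure (density lborel (\<lambda>x. ennreal (g x))) {..t} =
        (\<integral>\<^sup>+x. ennreal (g x) * indicator {..t} x \<partial>lborel)"
      by (simp add: emeasure_density)
    also have "\<dots> = (\<integral>\<^sup>+x. ennreal (f x) * indicator {0..t} x \<partial>lborel)"
      by (rule nn_integral_cong_AE, rule eventually_mono[OF ae]) (auto simp: g_def f_def indicator_def)
    also have "\<dots> = ennreal (H t - H 0)"
      by (rule nn_integral_FTC_Icc) (auto simp: Hd f0 t)
    finally have "P.prob {..t} = enn2real (ennreal (H t - H 0))"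
      by (simp add: measure_def)
    \<comment> \<open>Without this inequality \<open>ennreal\<close> would truncate the difference
      to 0.\<close>
    moreover have "H 0 \<le> H t"
      using Hd f0 by (intro DERIV_nonneg_imp_nondecreasing[OF t]) blast
    ultimately show ?thesis
      using E0 t by (auto simp: H_def split: if_splits)
  qed
qed

section \<open>Assembly of the switching time distribution\<close>

theorem proposition7:
  fixes E E' :: "real \<Rightarrow> real"
  assumes lim0: "(E \<longlongrightarrow> 1) (at_right 0)"
    and lim_infinity: "(E \<longlongrightarrow> 0) at_top"
    and deriv: "\<And>t. t > 0 \<Longrightarrow> (E has_real_derivative E' t) (at t)"
    and deriv0: "(E has_real_derivative E' 0) (at_right 0)"
    and deriv_nonpos: "\<And>t. t \<ge> 0 \<Longrightarrow> E' t \<le> 0"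
  shows "\<exists>F \<in> GD 2.
           ac_switching_distribution F \<and>
           ((\<forall>b\<ge>0. bounded (E' ` {0..b})) \<longrightarrow> switching_distribution F) \<and>
           expected_value_function F E"
proof -
  \<comment> \<open>The cut-off at 0 turns a bound for \<open>E'\<close> on \<open>{0..b}\<close>
    into one for \<open>g\<close> on all x \<le> b.\<close>
  define g where "g = (\<lambda>x. if 0 < x then - E' x else 0)"
  define G where "G = density lborel (\<lambda>x. ennreal (g x))"
  define F where "F = geometric_sum G"
  have g [measurable]: "g \<in> borel_measurable borel" and G: "prob_space G"
    and cdfG: "\<And>t. 0 \<le> t \<Longrightarrow> measure G {..t} = 1 - E t"
    unfolding G_def g_def
    using survival_function_density[OF lim0 lim_infinity deriv deriv0 deriv_nonpos] by blast+
  have g0: "0 \<le> g x" "x \<le> 0 \<Longrightarrow> g x = 0" for x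
    using deriv_nonpos by (auto simp: g_def)
  have SG: "sets G = sets borel" by (simp add: G_def)
  have posG: "AE x in G. 0 \<le> x"
    unfolding G_def
  proof (subst AE_density)
    show "AE x in lborel. 0 < ennreal (g x) \<longrightarrow> 0 \<le> x" by (auto simp: g_def)
  qed measurable
  have SF: "sets F = sets borel" by (simp add: F_def)
  have F: "prob_space F" and pos0F: "AE x in F. 0 \<le> x" and GD: "F \<in> GD 2"
    unfolding F_def using prob_space_geometric_sum[OF G SG posG] AE_geometric_sum_nonneg[OF G SG posG]
      geometric_sum_GD[OF G SG posG] by auto
  interpret F: prob_space F by (rule F)
  have renewal: "2 * (\<integral>\<^sup>+x. h x \<partial>F) = (\<integral>\<^sup>+x. h x \<partial>G) + (\<integral>\<^sup>+x. h x \<partial>(F \<star> G))"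
    if "h \<in> borel_measurable borel" for h
    unfolding F_def by (rule geometric_sum_renewal[OF G SG posG that])
  obtain f where f: "lebesgue_density F f"
    and f_le: "\<And>b K x. (\<And>x. x \<le> b \<Longrightarrow> g x \<le> K) \<Longrightarrow> x \<le> b \<Longrightarrow> f x \<le> K"
    using renewal_lebesgue_density[OF F SF pos0F g g0 G[unfolded G_def] renewal[unfolded G_def]] by metis
  \<comment> \<open>Having a density, \<open>F\<close> has no atom at 0. This upgrades nonnegativity
    to the strict positivity that rules out infinitely many switches in finite time.\<close>
  have posF: "AE x in F. 0 < x"
  proof -
    have "AE x in lborel. x \<noteq> (0::real)" by (rule AE_lborel_singleton)
    then have "AE x in F. x \<noteq> 0"
      using f unfolding lebesgue_density_def by (auto simp: AE_density elim: eventually_mono)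
    with pos0F show ?thesis by eventually_elim simp
  qed
  have cdf0: "cdf F 0 = 0"
  proof -
    have "F.prob {..0} = 0"
      by (subst F.prob_eq_0) (use posF in \<open>auto simp: SF elim: eventually_mono\<close>)
    then show ?thesis by (simp add: cdf_def)
  qed
  have ac: "ac_switching_distribution F"
    using F cdf0 f by (auto simp: ac_switching_distribution_def)
  have sw: "switching_distribution F" if bdd: "\<forall>b\<ge>0. bounded (E' ` {0..b})"
  proof -
    have "bounded (f ` {a..b})" if "0 \<le> a" "a \<le> b" for a b
    proof -
      from that have "bounded (E' ` {0..b})" using bdd by simp
      then obtain K where K: "\<And>x. x \<in> {0..b} \<Longrightarrow> \<bar>E' x\<bar> \<le> K"
        by (force simp: bounded_iff)
      have "0 \<le> K" using K[of 0] that by auto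
      then have "g x \<le> K" if "x \<le> b" for x
        using K[of x] that by (auto simp: g_def)
      then have "f x \<le> K" if "x \<le> b" for x
        using f_le that by blast
      moreover have "0 \<le> f x" for x using f by (simp add: lebesgue_density_def)
      ultimately show ?thesis by (auto simp: bounded_iff intro!: exI[of _ K])
    qed
    then show ?thesis using F cdf0 f by (auto simp: switching_distribution_def)
  qed
  have "expected_value_function F E"
  proof -
    \<comment> \<open>A single sequence must serve all times t at once; it is chosen before t is
      fixed.\<close>
    note iid = iid_nonneg_PiM[OF F SF pos0F]
    have "E t = prob_space.expectation (PiM UNIV (\<lambda>_. F)) (switch_process (\<lambda>k w. max 0 (w k)) t)"
      if "0 \<le> t" for t
      using expectation_switch_process[OF iid F SF posF that
          alternating_conv_power_tendsto[OF F SF posF G SG renewal that]] cdfG[OF that] by simp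
    with iid show ?thesis
      unfolding expected_value_function_def by blast
  qed
  with GD ac sw show ?thesis by blast
qed

end
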